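(* There is an absolute constant $C>0$ such that the following holds. For every continuous function $f:[0,1]\to[-1,1]$ and every positive integer $n$, there exist signs $\sigma_0,\dots,\sigma_n\in\{\pm1\}$ such that for all $x\in[0,1]$, with $X:=x(1-x)$, $$\left|f(x)-\sum_{k=0}^n\sigma_k\,p_{n,k}(x)\right|\le C\left(\omega_2\big(f,\sqrt{X/n}\big)+\frac{1}{1+\sqrt{nX}}\right).$$ In particular, if $f$ is Lipschitz, then (with such signs) for all $x\in[0,1]$, $$\left|f(x)-\sum_{k=0}^n\sigma_k\,p_{n,k}(x)\right|\le C\,\frac{1+|f|_{\mathrm{Lip}}}{1+\sqrt{nX}}.$$
   Context: For $0\le k\le n$, $p_{n,k}(x):=\binom{n}{k}x^k(1-x)^{n-k}$ are the Bernstein basis polynomials of order $n$. $\omega_2(f,t):=\sup_{0\le h\le t}\ \sup_{x,\,x+2h\in[0,1]}|f(x)-2f(x+h)+f(x+2h)|$ is the second modulus of smoothness of $f$ on $[0,1]$ in the uniform norm. $|f|_{\mathrm{Lip}}$ is the Lipschitz seminorm (smallest Lipschitz constant) of $f$ on $[0,1]$. *)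

theory Defs
  imports "HOL-Analysis.Analysis"
begin

(* The supremum is taken jointly over x and h, which agrees with the iterated supremum
   but never involves the (unspecified) real supremum of an empty set: for t > 1/2 some
   admissible h have no admissible x. For t >= 0 and f bounded on [0,1], the set is nonempty
   and bounded above. *)
definition omega2 :: "(real \<Rightarrow> real) \<Rightarrow> real \<Rightarrow> real" where
  "omega2 f t = (SUP (x, h) \<in> {(x, h). 0 \<le> h \<and> h \<le> t \<and> x \<in> {0..1} \<and> x + 2 * h \<in> {0..1}}.
     \<bar>f x - 2 * f (x + h) + f (x + 2 * h)\<bar>)"

(* Meaningful only if f is Lipschitz on [0,1]; the infimum is then a minimum. *)
definition lip_seminorm :: "(real \<Rightarrow> real) \<Rightarrow> real" where
  "lip_seminorm f = Inf {L. L-lipschitz_on {0..1} f}"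

end

theory Submission
  imports Defs
begin

text \<open>
  Put \<open>t = sqrt (X / n)\<close>. If \<open>n X < 1\<close>, the bound is trivial. Otherwise \<open>[x - t, x + t]\<close> lies in
  \<open>[0, 1]\<close>; subtracting from \<open>f\<close> the affine function interpolating it at \<open>x - t\<close> and \<open>x + t\<close>
  leaves a remainder of size at most \<open>3 \<omega>\<^sub>2(f, t) (1 + ((y - x) / t)\<^sup>2)\<close> at every \<open>y\<close>, and since the
  Bernstein operator is positive, reproduces affine functions and has variance \<open>X / n = t\<^sup>2\<close>,
  it follows that \<open>|f(x) - B\<^sub>n f(x)| \<le> 7 \<omega>\<^sub>2(f, t)\<close>. The coefficients \<open>f(k/n)\<close> are then rounded to
  signs by first-order sigma-delta quantization, which keeps all partial sums of the errors in
  \<open>[-1, 1]\<close>; summation by parts bounds the quantization error by the total variation of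
  \<open>k \<mapsto> p\<^sub>n\<^sub>,\<^sub>k(x)\<close>. As \<open>(n + 1) X (p\<^sub>n\<^sub>,\<^sub>k - p\<^sub>n\<^sub>,\<^sub>k\<^sub>+\<^sub>1) = (k + 1 - (n + 1) x) p\<^sub>n\<^sub>+\<^sub>1\<^sub>,\<^sub>k\<^sub>+\<^sub>1\<close>, this variation is an
  absolute first moment, at most \<open>1 / sqrt ((n + 1) X)\<close>.
\<close>

section \<open>Moments and recurrences of the Bernstein basis\<close>

lemma Bernstein_eq_0: "n < k \<Longrightarrow> Bernstein n k x = 0"
  by (simp add: Bernstein_def binomial_eq_0)

lemma Bernstein_first_moment: "(\<Sum>k\<le>n. (real k - real n * x) * Bernstein n k x) = 0"
proof -
  have "(\<Sum>k\<le>n. (real k - real n * x) * Bernstein n k x)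
      = (\<Sum>k\<le>n. real k * Bernstein n k x) - real n * x * (\<Sum>k\<le>n. Bernstein n k x)"
    by (simp only: left_diff_distrib sum_subtractf sum_distrib_left)
  then show ?thesis
    by simp
qed

lemma Bernstein_variance:
  "(\<Sum>k\<le>n. (real k - real n * x)\<^sup>2 * Bernstein n k x) = real n * (x * (1 - x))"
proof -
  \<comment> \<open>The known sums are those against \<open>k * (k - 1)\<close>, \<open>k\<close>
    and \<open>1\<close>, so the square is expanded in these.\<close>
  have "(real k - real n * x)\<^sup>2 * Bernstein n k x =
      real k * (real k - 1) * Bernstein n k x + (1 - 2 * real n * x) * (real k * Bernstein n k x)
      + (real n * x)\<^sup>2 * Bernstein n k x" for k
    by (simp add: power2_eq_square algebra_simps)
  then have "(\<Sum>k\<le>n. (real k - real n * x)\<^sup>2 * Bernstein n k x) =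
      (\<Sum>k\<le>n. real k * (real k - 1) * Bernstein n k x)
      + (1 - 2 * real n * x) * (\<Sum>k\<le>n. real k * Bernstein n k x)
      + (real n * x)\<^sup>2 * (\<Sum>k\<le>n. Bernstein n k x)"
    by (simp only: sum.distrib sum_distrib_left)
  also have "\<dots> = real n * (x * (1 - x))"
    unfolding sum_kk_Bernstein sum_k_Bernstein sum_Bernstein
    by (simp add: power2_eq_square algebra_simps)
  finally show ?thesis .
qed

text \<open>Pascal's rule. For \<open>k = n\<close> the exponent \<open>n - Suc k\<close> is
  truncated, so that case is separate; its last term vanishes through the binomial
  coefficient.\<close>

lemma Bernstein_Suc_Suc:
  assumes "k \<le> n"
  shows "Bernstein (Suc n) (Suc k) x = x * Bernstein n k x + (1 - x) * Bernstein n (Suc k) x"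
proof (cases "k = n")
  case True
  then show ?thesis by (simp add: Bernstein_def)
next
  case False
  with assms have "n - k = Suc (n - Suc k)" by simp
  then show ?thesis by (simp add: Bernstein_def algebra_simps)
qed

lemma Suc_times_Bernstein:
  "real (Suc k) * Bernstein (Suc n) (Suc k) x = real (Suc n) * x * Bernstein n k x"
proof -
  have "real (Suc k) * real (Suc n choose Suc k) = real (Suc n) * real (n choose k)"
    by (metis Suc_times_binomial of_nat_mult)
  then show ?thesis
    unfolding Bernstein_def diff_Suc_Suc power_Suc
    by (metis (no_types, opaque_lifting) mult.assoc mult.left_commute)
qed

text \<open>Absorption rewrites the \<open>Suc k\<close> part, and Pascal's rule for the rest leaves
  a factor \<open>1 - x\<close> on the difference. The right side is centred at the mean of order
  \<open>Suc n\<close>, so its absolute values sum to part of an absolute first moment.\<close>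

lemma Bernstein_diff:
  assumes "k \<le> n"
  shows "real (Suc n) * (x * (1 - x)) * (Bernstein n k x - Bernstein n (Suc k) x)
    = (real (Suc k) - real (Suc n) * x) * Bernstein (Suc n) (Suc k) x"
proof -
  have "(real (Suc k) - real (Suc n) * x) * Bernstein (Suc n) (Suc k) x
     = real (Suc n) * x * Bernstein n k x - real (Suc n) * x * Bernstein (Suc n) (Suc k) x"
    by (metis Suc_times_Bernstein left_diff_distrib)
  also have "\<dots> = real (Suc n) * (x * (1 - x)) * (Bernstein n k x - Bernstein n (Suc k) x)"
    unfolding Bernstein_Suc_Suc[OF assms] by (simp add: algebra_simps)
  finally show ?thesis by simp
qed

section \<open>Total variation of the basis in its index\<close>

text \<open>In place of Cauchy-Schwarz, the square is completed with \<open>s\<close> equal to the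
  standard deviation; the variance term and the constant term then contribute \<open>s / 2\<close>
  each.\<close>

lemma Bernstein_abs_moment:
  assumes x: "x \<in> {0..1}" and s: "real n * (x * (1 - x)) = s\<^sup>2" "s > 0"
  shows "(\<Sum>k\<le>n. \<bar>real k - real n * x\<bar> * Bernstein n k x) \<le> s"
proof -
  have "\<bar>d\<bar> \<le> (d\<^sup>2 / s + s) / 2" for d
  proof -
    have "0 \<le> (\<bar>d\<bar> - s)\<^sup>2" by simp
    then show ?thesis using s(2) by (simp add: power2_eq_square field_simps)
  qed
  then have "(\<Sum>k\<le>n. \<bar>real k - real n * x\<bar> * Bernstein n k x)
      \<le> (\<Sum>k\<le>n. ((real k - real n * x)\<^sup>2 / s + s) / 2 * Bernstein n k x)"
    using x by (intro sum_mono mult_right_mono) (auto simp: Bernstein_nonneg)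
  also have "\<dots> = (\<Sum>k\<le>n. (real k - real n * x)\<^sup>2 * Bernstein n k x) / s / 2
      + s / 2 * (\<Sum>k\<le>n. Bernstein n k x)"
    by (simp only: add_divide_distrib distrib_right sum.distrib sum_distrib_left sum_divide_distrib
        times_divide_eq_left)
  also have "\<dots> = s"
    unfolding Bernstein_variance s(1) using s(2) by (simp add: power2_eq_square)
  finally show ?thesis .
qed

text \<open>This crude bound covers small \<open>n * x * (1 - x)\<close>, where the moment bound
  degenerates.\<close>

lemma Bernstein_variation_le_2:
  assumes "x \<in> {0..1}"
  shows "(\<Sum>k\<le>n. \<bar>Bernstein n k x - Bernstein n (Suc k) x\<bar>) \<le> 2"
proof -
  have nn: "0 \<le> Bernstein n k x" for k
    using assms by (auto simp: Bernstein_nonneg)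
  have "(\<Sum>k\<le>n. \<bar>Bernstein n k x - Bernstein n (Suc k) x\<bar>)
      \<le> (\<Sum>k\<le>n. Bernstein n k x + Bernstein n (Suc k) x)"
    using nn by (intro sum_mono) (smt (verit))
  also have "(\<Sum>k\<le>n. Bernstein n k x + Bernstein n (Suc k) x)
      = 1 + (\<Sum>k\<le>n. Bernstein n (Suc k) x)"
    by (simp add: sum.distrib)
  also have "(\<Sum>k\<le>n. Bernstein n (Suc k) x) \<le> (\<Sum>k\<le>Suc n. Bernstein n k x)"
    using nn[of 0] by (simp add: sum.atMost_Suc_shift del: sum.atMost_Suc)
  also have "\<dots> = 1"
    by (simp add: Bernstein_eq_0)
  finally show ?thesis by simp
qed

lemma Bernstein_variation_le:
  assumes x: "x \<in> {0..1}" and pos: "x * (1 - x) > 0"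
  shows "sqrt (real (Suc n) * (x * (1 - x)))
    * (\<Sum>k\<le>n. \<bar>Bernstein n k x - Bernstein n (Suc k) x\<bar>) \<le> 1"
proof -
  define V where "V = (\<Sum>k\<le>n. \<bar>Bernstein n k x - Bernstein n (Suc k) x\<bar>)"
  define s where "s = sqrt (real (Suc n) * (x * (1 - x)))"
  have s: "real (Suc n) * (x * (1 - x)) = s\<^sup>2" "s > 0"
    using pos by (auto simp: s_def)
  have nn: "0 \<le> Bernstein (Suc n) k x" for k
    using x by (auto simp: Bernstein_nonneg)
  have eq: "s\<^sup>2 * \<bar>Bernstein n k x - Bernstein n (Suc k) x\<bar>
      = \<bar>real (Suc k) - real (Suc n) * x\<bar> * Bernstein (Suc n) (Suc k) x" if "k \<le> n" for k
  proof -
    have "s\<^sup>2 * \<bar>Bernstein n k x - Bernstein n (Suc k) x\<bar>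
        = \<bar>s\<^sup>2 * (Bernstein n k x - Bernstein n (Suc k) x)\<bar>"
      by (simp add: abs_mult)
    also have "\<dots> = \<bar>(real (Suc k) - real (Suc n) * x) * Bernstein (Suc n) (Suc k) x\<bar>"
      using Bernstein_diff[OF that, of x] s(1) by metis
    finally show ?thesis using nn by (simp add: abs_mult)
  qed
  have "s\<^sup>2 * V = (\<Sum>k\<le>n. \<bar>real (Suc k) - real (Suc n) * x\<bar> * Bernstein (Suc n) (Suc k) x)"
    unfolding V_def sum_distrib_left by (intro sum.cong) (simp_all only: eq atMost_iff)
  \<comment> \<open>The index shift adds only the nonnegative term at \<open>k = 0\<close>.\<close>
  also have "\<dots> \<le> (\<Sum>k\<le>Suc n. \<bar>real k - real (Suc n) * x\<bar> * Bernstein (Suc n) k x)"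
    using nn[of 0] unfolding sum.atMost_Suc_shift by simp
  also have "\<dots> \<le> s"
    by (rule Bernstein_abs_moment[OF x s])
  finally have "s * (s * V) \<le> s * 1"
    by (simp add: power2_eq_square mult.assoc)
  then show ?thesis
    using s(2) unfolding V_def s_def by (simp del: of_nat_Suc)
qed

text \<open>The constant 3 is the sum of \<open>V \<le> 2\<close> and \<open>s * V \<le> 1\<close>.
  The second comes from the bound with \<open>Suc n\<close> by monotonicity of the root, and is
  trivial at the endpoints, where \<open>s = 0\<close>.\<close>

lemma Bernstein_variation:
  assumes x: "x \<in> {0..1}"
  shows "(\<Sum>k\<le>n. \<bar>Bernstein n k x - Bernstein n (Suc k) x\<bar>)
    \<le> 3 / (1 + sqrt (real n * (x * (1 - x))))"
proof -
  define V where "V = (\<Sum>k\<le>n. \<bar>Bernstein n k x - Bernstein n (Suc k) x\<bar>)"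
  define s where "s = sqrt (real n * (x * (1 - x)))"
  have X: "0 \<le> x * (1 - x)" using x by simp
  then have s0: "0 \<le> s" by (simp add: s_def)
  have V0: "0 \<le> V" by (simp add: V_def sum_nonneg)
  have V2: "V \<le> 2" unfolding V_def by (rule Bernstein_variation_le_2[OF x])
  have "s * V \<le> 1"
  proof (cases "x * (1 - x) = 0")
    case False
    with X have "x * (1 - x) > 0" by linarith
    then have *: "sqrt (real (Suc n) * (x * (1 - x))) * V \<le> 1"
      unfolding V_def by (rule Bernstein_variation_le[OF x])
    have "s \<le> sqrt (real (Suc n) * (x * (1 - x)))"
      unfolding s_def using X by (intro real_sqrt_le_mono mult_right_mono) auto
    from mult_right_mono[OF this V0] * show ?thesis by simp
  qed (simp only: s_def, simp)
  with V2 have "(1 + s) * V \<le> 3" by (simp add: algebra_simps)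
  then have "V \<le> 3 / (1 + s)" using s0 by (simp add: field_simps)
  then show ?thesis by (simp add: V_def s_def)
qed

section \<open>Sigma-delta quantization of the coefficients\<close>

text \<open>The choice is greedy: \<open>S k + a k\<close> lies in \<open>[-2, 2]\<close>, and
  subtracting its sign brings it back to \<open>[-1, 1]\<close>. \<open>S k\<close> collects the
  errors at indices below \<open>k\<close>, hence the range up to \<open>Suc n\<close>. The signs
  depend on \<open>a\<close> alone, so one choice serves all \<open>x\<close>.\<close>

lemma sigma_delta:
  fixes a :: "nat \<Rightarrow> real"
  assumes "\<And>k. k \<le> n \<Longrightarrow> \<bar>a k\<bar> \<le> 1"
  obtains \<sigma> :: "nat \<Rightarrow> real" and S :: "nat \<Rightarrow> real"
  where "\<And>k. \<sigma> k \<in> {-1, 1}" "S 0 = 0" "\<And>k. S (Suc k) = S k + (a k - \<sigma> k)"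
    "\<And>k. k \<le> Suc n \<Longrightarrow> \<bar>S k\<bar> \<le> 1"
proof -
  define sg :: "real \<Rightarrow> real" where "sg y = (if y \<ge> 0 then 1 else - 1)" for y
  define S where "S = rec_nat 0 (\<lambda>k s. s + (a k - sg (s + a k)))"
  define \<sigma> where "\<sigma> k = sg (S k + a k)" for k
  have S_Suc: "S (Suc k) = S k + (a k - \<sigma> k)" for k
    by (simp add: S_def \<sigma>_def)
  have "\<bar>S k\<bar> \<le> 1" if "k \<le> Suc n" for k
    using that
  proof (induction k)
    case 0
    then show ?case by (simp add: S_def)
  next
    case (Suc k)
    then have "\<bar>S k\<bar> \<le> 1" "\<bar>a k\<bar> \<le> 1" using assms by auto
    then show ?case unfolding S_Suc \<sigma>_def sg_def by (auto simp: abs_if split: if_splits)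
  qed
  moreover have "\<sigma> k \<in> {-1, 1}" for k by (simp add: \<sigma>_def sg_def)
  moreover have "S 0 = 0" by (simp add: S_def)
  ultimately show ?thesis using that S_Suc by blast
qed

lemma Bernstein_quantization:
  fixes a :: "nat \<Rightarrow> real"
  assumes "\<And>k. k \<le> n \<Longrightarrow> \<bar>a k\<bar> \<le> 1"
  obtains \<sigma> :: "nat \<Rightarrow> real"
  where "\<And>k. \<sigma> k \<in> {-1, 1}"
    "\<And>x. x \<in> {0..1} \<Longrightarrow> \<bar>(\<Sum>k\<le>n. a k * Bernstein n k x) - (\<Sum>k\<le>n. \<sigma> k * Bernstein n k x)\<bar>
      \<le> 3 / (1 + sqrt (real n * (x * (1 - x))))"
proof -
  obtain \<sigma> S :: "nat \<Rightarrow> real" where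
    \<sigma>: "\<And>k. \<sigma> k \<in> {-1, 1}" and S0: "S 0 = 0" and S_Suc: "\<And>k. S (Suc k) = S k + (a k - \<sigma> k)"
    and S_le: "\<And>k. k \<le> Suc n \<Longrightarrow> \<bar>S k\<bar> \<le> 1"
    using sigma_delta[where a = a and n = n] assms by blast
  have "\<bar>(\<Sum>k\<le>n. a k * Bernstein n k x) - (\<Sum>k\<le>n. \<sigma> k * Bernstein n k x)\<bar>
      \<le> 3 / (1 + sqrt (real n * (x * (1 - x))))" if x: "x \<in> {0..1}" for x
  proof -
    let ?p = "\<lambda>k. Bernstein n k x"
    \<comment> \<open>Summation by parts, with the upper limit \<open>m\<close> separated from the
      order \<open>n\<close> for the induction. At \<open>m = n\<close> the boundary term vanishes,
      as \<open>?p (Suc n) = 0\<close>.\<close>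
    have parts: "(\<Sum>k\<le>m. (a k - \<sigma> k) * ?p k)
        = (\<Sum>k\<le>m. S (Suc k) * (?p k - ?p (Suc k))) + S (Suc m) * ?p (Suc m)" for m
      by (induction m) (auto simp: S_Suc S0 algebra_simps)
    have "(\<Sum>k\<le>n. a k * ?p k) - (\<Sum>k\<le>n. \<sigma> k * ?p k) = (\<Sum>k\<le>n. S (Suc k) * (?p k - ?p (Suc k)))"
      using parts[of n] by (simp add: Bernstein_eq_0 sum_subtractf left_diff_distrib)
    also have "\<bar>\<dots>\<bar> \<le> (\<Sum>k\<le>n. \<bar>S (Suc k) * (?p k - ?p (Suc k))\<bar>)"
      by (rule sum_abs)
    also have "\<dots> \<le> (\<Sum>k\<le>n. \<bar>?p k - ?p (Suc k)\<bar>)"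
    proof (rule sum_mono)
      fix k assume "k \<in> {..n}"
      then have "\<bar>S (Suc k)\<bar> \<le> 1" by (intro S_le) simp
      then show "\<bar>S (Suc k) * (?p k - ?p (Suc k))\<bar> \<le> \<bar>?p k - ?p (Suc k)\<bar>"
        unfolding abs_mult by (intro mult_left_le_one_le) auto
    qed
    also have "\<dots> \<le> 3 / (1 + sqrt (real n * (x * (1 - x))))"
      by (rule Bernstein_variation[OF x])
    finally show ?thesis .
  qed
  with \<sigma> show ?thesis using that by blast
qed

section \<open>Local affine approximation from second differences\<close>

text \<open>Halving against a zero at an endpoint gives \<open>M \<le> (M + w) / 2\<close> for the
  supremum \<open>M\<close>, hence \<open>M \<le> w\<close>. The bound \<open>K\<close> makes
  \<open>M\<close> finite.\<close>

lemma abs_le_second_difference: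
  fixes g :: "real \<Rightarrow> real"
  assumes bdd: "\<And>y. y \<in> {a..b} \<Longrightarrow> \<bar>g y\<bar> \<le> K"
    and diff2: "\<And>y h. 0 \<le> h \<Longrightarrow> a \<le> y \<Longrightarrow> y + 2 * h \<le> b \<Longrightarrow>
      \<bar>g y - 2 * g (y + h) + g (y + 2 * h)\<bar> \<le> w"
    and "g a = 0" "g b = 0" and y: "y \<in> {a..b}"
  shows "\<bar>g y\<bar> \<le> w"
proof -
  define M where "M = (SUP y\<in>{a..b}. \<bar>g y\<bar>)"
  have le_M: "\<bar>g z\<bar> \<le> M" if "z \<in> {a..b}" for z
    unfolding M_def using that bdd by (intro cSUP_upper) (auto intro!: bdd_aboveI2[where M = K])
  \<comment> \<open>Every point is the midpoint of an endpoint and another point of the interval.\<close>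
  have "\<bar>g z\<bar> \<le> (M + w) / 2" if z: "z \<in> {a..b}" for z
  proof (cases "z \<le> (a + b) / 2")
    case True
    with z have "\<bar>g a - 2 * g z + g (2 * z - a)\<bar> \<le> w" "\<bar>g (2 * z - a)\<bar> \<le> M"
      using diff2[of "z - a" a] le_M[of "2 * z - a"] by (auto simp: algebra_simps)
    with \<open>g a = 0\<close> show ?thesis by argo
  next
    case False
    with z have "\<bar>g (2 * z - b) - 2 * g z + g b\<bar> \<le> w" "\<bar>g (2 * z - b)\<bar> \<le> M"
      using diff2[of "b - z" "2 * z - b"] le_M[of "2 * z - b"] by (auto simp: algebra_simps)
    with \<open>g b = 0\<close> show ?thesis by argo
  qed
  then have "M \<le> (M + w) / 2"
    unfolding M_def using y by (intro cSUP_least) auto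
  with le_M[OF y] show ?thesis by argo
qed

text \<open>From a starting point \<open>v\<close> in \<open>[0, t]\<close>, \<open>u\<close> is
  reached in \<open>j\<close> steps of length \<open>t\<close>. Each step changes the first
  difference by at most \<open>w\<close>, so the values grow at most quadratically in
  \<open>j\<close>.\<close>

lemma quadratic_growth:
  fixes g :: "real \<Rightarrow> real"
  assumes t: "t > 0" and u: "0 \<le> u" "u \<le> c"
    and near: "\<And>y. \<bar>y\<bar> \<le> t \<Longrightarrow> \<bar>g y\<bar> \<le> w"
    and diff2: "\<And>y. - t \<le> y \<Longrightarrow> y + 2 * t \<le> c \<Longrightarrow> \<bar>g y - 2 * g (y + t) + g (y + 2 * t)\<bar> \<le> w"
  shows "\<bar>g u\<bar> \<le> 3 * w * (1 + (u / t)\<^sup>2)"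
proof -
  define j where "j = nat \<lfloor>u / t\<rfloor>"
  define v where "v = u - real j * t"
  have w: "0 \<le> w" using near[of 0] t by simp
  have "real j = of_int \<lfloor>u / t\<rfloor>" unfolding j_def using u t by simp
  then have j: "real j \<le> u / t" "u / t < real j + 1" by linarith+
  then have v: "0 \<le> v" "v \<le> t" unfolding v_def using t by (auto simp: field_simps)
  \<comment> \<open>Both \<open>v\<close> and \<open>v - t\<close> lie in \<open>[-t, t]\<close>, so
    the first difference starts at most at \<open>2 * w\<close>. Adding the bounds
    \<open>(2 + l) * w\<close> for \<open>l = 1, ..., i\<close> to the initial \<open>w\<close>
    gives the second estimate.\<close>
  have *: "\<bar>g (v + real i * t) - g (v + real i * t - t)\<bar> \<le> (2 + real i) * w \<and>
      \<bar>g (v + real i * t)\<bar> \<le> (1 + 2 * real i + real i * (real i + 1) / 2) * w"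
    if "v + real i * t \<le> c" for i
    using that
  proof (induction i)
    case 0
    then show ?case using near[of v] near[of "v - t"] v by auto
  next
    case (Suc i)
    let ?z = "v + real i * t"
    have "0 \<le> real i * t" using t by simp
    then have "\<bar>g (?z - t) - 2 * g ?z + g (?z + t)\<bar> \<le> w"
      using diff2[of "?z - t"] v Suc.prems by (simp add: algebra_simps)
    moreover have "\<bar>g ?z - g (?z - t)\<bar> \<le> (2 + real i) * w"
      "\<bar>g ?z\<bar> \<le> (1 + 2 * real i + real i * (real i + 1) / 2) * w"
      using Suc t by (auto simp: algebra_simps)
    moreover have "v + real (Suc i) * t = ?z + t" by (simp add: algebra_simps)
    ultimately have "\<bar>g (v + real (Suc i) * t) - g (v + real (Suc i) * t - t)\<bar> \<le> w + (2 + real i) * w"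
      "\<bar>g (v + real (Suc i) * t)\<bar>
        \<le> (1 + 2 * real i + real i * (real i + 1) / 2) * w + (w + (2 + real i) * w)"
      by (simp_all only: add_diff_cancel_right')
    then show ?case by (simp add: field_simps)
  qed
  have "v + real j * t = u" by (simp add: v_def)
  with *[of j] u have "\<bar>g u\<bar> \<le> (1 + 2 * real j + real j * (real j + 1) / 2) * w" by simp
  also have "\<dots> \<le> (3 * (1 + (real j)\<^sup>2)) * w"
  proof (intro mult_right_mono w)
    \<comment> \<open>Using \<open>j \<le> (1 + j^2) / 2\<close> on the linear terms gives
      \<open>9/4 + 7/4 * j^2\<close>, within the claimed bound.\<close>
    have "2 * real j \<le> 1 + (real j)\<^sup>2"
      using zero_le_power2[of "real j - 1"] by (simp add: power2_eq_square algebra_simps)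
    moreover have "0 \<le> (real j)\<^sup>2" by simp
    moreover have "real j * (real j + 1) / 2 = (real j)\<^sup>2 / 2 + real j / 2"
      by (simp add: power2_eq_square field_simps)
    ultimately show "1 + 2 * real j + real j * (real j + 1) / 2 \<le> 3 * (1 + (real j)\<^sup>2)"
      by argo
  qed
  also have "\<dots> \<le> (3 * (1 + (u / t)\<^sup>2)) * w"
    using j by (intro mult_right_mono w mult_left_mono add_left_mono power_mono) auto
  finally show ?thesis by (simp add: mult_ac)
qed

text \<open>The affine function interpolates \<open>f\<close> at \<open>x - t\<close> and
  \<open>x + t\<close>, and subtracting it preserves second differences. The midpoint argument
  controls the remainder on \<open>[x - t, x + t]\<close>, and quadratic growth extends this to both
  sides. The value at \<open>x\<close> has its own sharper bound.\<close>

lemma affine_approximation: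
  fixes f :: "real \<Rightarrow> real"
  assumes t: "t > 0" and "0 \<le> x - t" "x + t \<le> 1"
    and bdd: "\<And>y. y \<in> {0..1} \<Longrightarrow> \<bar>f y\<bar> \<le> K"
    and diff2: "\<And>y h. 0 \<le> h \<Longrightarrow> h \<le> t \<Longrightarrow> 0 \<le> y \<Longrightarrow> y + 2 * h \<le> 1 \<Longrightarrow>
      \<bar>f y - 2 * f (y + h) + f (y + 2 * h)\<bar> \<le> w"
  obtains A B where "\<bar>f x - A\<bar> \<le> w"
    "\<And>y. y \<in> {0..1} \<Longrightarrow> \<bar>f y - (A + B * (y - x))\<bar> \<le> 3 * w * (1 + ((y - x) / t)\<^sup>2)"
proof -
  define A where "A = (f (x + t) + f (x - t)) / 2"
  define B where "B = (f (x + t) - f (x - t)) / (2 * t)"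
  define g where "g u = f (x + u) - (A + B * u)" for u
  have g0: "g (- t) = 0" "g t = 0"
    using t by (simp_all add: g_def A_def B_def field_simps)
  have g2: "\<bar>g y - 2 * g (y + h) + g (y + 2 * h)\<bar> \<le> w"
    if "0 \<le> h" "h \<le> t" "- x \<le> y" "y + 2 * h \<le> 1 - x" for y h
  proof -
    have "g y - 2 * g (y + h) + g (y + 2 * h) = f (x + y) - 2 * f (x + y + h) + f (x + y + 2 * h)"
      by (simp add: g_def algebra_simps)
    then show ?thesis using diff2[of h "x + y"] that by simp
  qed
  have gb: "\<bar>g y\<bar> \<le> K + \<bar>A\<bar> + \<bar>B\<bar> * t" if "y \<in> {- t..t}" for y
  proof -
    have "\<bar>f (x + y)\<bar> \<le> K" using assms that by (intro bdd) auto
    moreover have "\<bar>B * y\<bar> \<le> \<bar>B\<bar> * t"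
      unfolding abs_mult using that by (intro mult_left_mono) auto
    ultimately show ?thesis unfolding g_def by linarith
  qed
  have near: "\<bar>g y\<bar> \<le> w" if "\<bar>y\<bar> \<le> t" for y
    using that assms(2,3)
    by (intro abs_le_second_difference[where g = g and a = "- t" and b = t, OF gb g2])
      (auto simp: g0)
  have far: "\<bar>g u\<bar> \<le> 3 * w * (1 + (u / t)\<^sup>2)" if u: "- x \<le> u" "u \<le> 1 - x" for u
  proof (cases "0 \<le> u")
    case True
    show ?thesis
      using assms(2) t by (intro quadratic_growth[OF t True u(2) near] g2) auto
  next
    case False
    \<comment> \<open>Points to the left are handled by reflecting \<open>g\<close>; the available
      range is then \<open>x\<close> instead of \<open>1 - x\<close>.\<close>
    have "\<bar>g (- (- u))\<bar> \<le> 3 * w * (1 + (- u / t)\<^sup>2)"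
    proof (rule quadratic_growth[OF t, where c = x and g = "\<lambda>y. g (- y)"])
      fix y assume "- t \<le> y" "y + 2 * t \<le> x"
      then show "\<bar>g (- y) - 2 * g (- (y + t)) + g (- (y + 2 * t))\<bar> \<le> w"
        using g2[of t "- (y + 2 * t)"] assms(3) t by (simp add: algebra_simps)
    qed (use False u near in auto)
    then show ?thesis by simp
  qed
  show ?thesis
  proof (rule that)
    show "\<bar>f x - A\<bar> \<le> w" using near[of 0] t by (simp add: g_def)
    show "\<bar>f y - (A + B * (y - x))\<bar> \<le> 3 * w * (1 + ((y - x) / t)\<^sup>2)" if "y \<in> {0..1}" for y
      using far[of "y - x"] that by (simp add: g_def)
  qed
qed

section \<open>Pointwise approximation by the Bernstein operator\<close>

lemma Bernstein_approximation:
  fixes f :: "real \<Rightarrow> real"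
  assumes n: "n > 0" and x: "x \<in> {0..1}" and large: "real n * (x * (1 - x)) \<ge> 1"
    and bdd: "\<And>y. y \<in> {0..1} \<Longrightarrow> \<bar>f y\<bar> \<le> K"
    and diff2: "\<And>y h. 0 \<le> h \<Longrightarrow> h \<le> sqrt (x * (1 - x) / real n) \<Longrightarrow> 0 \<le> y \<Longrightarrow> y + 2 * h \<le> 1 \<Longrightarrow>
      \<bar>f y - 2 * f (y + h) + f (y + 2 * h)\<bar> \<le> w"
  shows "\<bar>f x - (\<Sum>k\<le>n. f (real k / real n) * Bernstein n k x)\<bar> \<le> 7 * w"
proof -
  define X where "X = x * (1 - x)"
  define t where "t = sqrt (X / real n)"
  have X: "X > 0" using large n unfolding X_def by (smt (verit) mult_nonneg_nonpos of_nat_0_le_iff)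
  have t: "t > 0" "t\<^sup>2 = X / real n" using X n by (auto simp: t_def)
  \<comment> \<open>The assumption \<open>large\<close> amounts to \<open>t \<le> X\<close>, and
    \<open>X\<close> is at most the distance from \<open>x\<close> to either endpoint, so the
    interpolation nodes lie in \<open>[0, 1]\<close>.\<close>
  have "1 / real n \<le> X" using large n by (simp add: X_def field_simps)
  then have "X / real n \<le> X\<^sup>2" using X using mult_left_mono[of "1 / real n" X X] by (simp add: power2_eq_square)
  then have "t \<le> X" unfolding t_def using X by (simp add: real_le_lsqrt)
  moreover have "X \<le> x" "X \<le> 1 - x"
    unfolding X_def using x by (auto simp: mult_left_le mult_left_le_one_le)
  ultimately have "0 \<le> x - t" "x + t \<le> 1" by linarith+
  from affine_approximation[OF t(1) this bdd diff2[folded X_def t_def]]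
  obtain A B where A: "\<bar>f x - A\<bar> \<le> w" and
    AB: "\<And>y. y \<in> {0..1} \<Longrightarrow> \<bar>f y - (A + B * (y - x))\<bar> \<le> 3 * w * (1 + ((y - x) / t)\<^sup>2)"
    by blast
  let ?p = "\<lambda>k. Bernstein n k x"
  have nn: "0 \<le> ?p k" for k using x by (auto simp: Bernstein_nonneg)
  have kx: "real k / real n - x = (real k - real n * x) / real n" for k
    using n by (simp add: field_simps)
  have "(\<Sum>k\<le>n. (A + B * (real k / real n - x)) * ?p k)
      = A * (\<Sum>k\<le>n. ?p k) + B / real n * (\<Sum>k\<le>n. (real k - real n * x) * ?p k)"
    by (simp only: kx distrib_right sum.distrib sum_distrib_left mult.assoc times_divide_eq_left
        times_divide_eq_right)
  also have "\<dots> = A"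
    by (simp add: Bernstein_first_moment)
  finally have "(\<Sum>k\<le>n. (A + B * (real k / real n - x)) * ?p k) = A" .
  then have "\<bar>(\<Sum>k\<le>n. f (real k / real n) * ?p k) - A\<bar>
      = \<bar>\<Sum>k\<le>n. (f (real k / real n) - (A + B * (real k / real n - x))) * ?p k\<bar>"
    by (simp add: left_diff_distrib sum_subtractf)
  also have "\<dots> \<le> (\<Sum>k\<le>n. \<bar>f (real k / real n) - (A + B * (real k / real n - x))\<bar> * ?p k)"
    by (rule order_trans[OF sum_abs]) (simp add: abs_mult nn)
  also have "\<dots> \<le> (\<Sum>k\<le>n. 3 * w * (1 + ((real k / real n - x) / t)\<^sup>2) * ?p k)"
    using n by (intro sum_mono mult_right_mono AB nn) auto
  also have "\<dots> = 3 * w * ((\<Sum>k\<le>n. ?p k)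
      + (\<Sum>k\<le>n. (real k - real n * x)\<^sup>2 * ?p k) / ((real n)\<^sup>2 * t\<^sup>2))"
    by (simp only: kx sum_distrib_left sum.distrib sum_divide_distrib power_divide distrib_left
        distrib_right mult_1_right mult.assoc times_divide_eq_left divide_divide_eq_left
        times_divide_eq_right power_mult_distrib)
  \<comment> \<open>The variance of \<open>k / n\<close> is exactly \<open>t^2\<close>, so the
    bracket equals 2. Adding \<open>\<bar>f x - A\<bar> \<le> w\<close> yields the constant
    7.\<close>
  also have "\<dots> = 6 * w"
    unfolding Bernstein_variance sum_Bernstein t(2) X_def[symmetric]
    using n X by (simp add: power2_eq_square)
  finally show ?thesis using A by linarith
qed

section \<open>The modulus of smoothness and the Lipschitz seminorm\<close>

text \<open>All admissible second differences are at most \<open>4 * K\<close>, so the real supremum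
  is a genuine upper bound.\<close>

lemma second_difference_le_omega2:
  fixes f :: "real \<Rightarrow> real"
  assumes bdd: "\<And>y. y \<in> {0..1} \<Longrightarrow> \<bar>f y\<bar> \<le> K"
    and "0 \<le> h" "h \<le> t" "0 \<le> y" "y + 2 * h \<le> 1"
  shows "\<bar>f y - 2 * f (y + h) + f (y + 2 * h)\<bar> \<le> omega2 f t"
proof -
  let ?I = "{(x, h). 0 \<le> h \<and> h \<le> t \<and> x \<in> {0..1} \<and> x + 2 * h \<in> {0..1::real}}"
  let ?F = "\<lambda>(x, h). \<bar>f x - 2 * f (x + h) + f (x + 2 * h)\<bar>"
  have "?F p \<le> 4 * K" if "p \<in> ?I" for p
  proof -
    obtain z d where p: "p = (z, d)" by (cases p)
    with that have "\<bar>f z\<bar> \<le> K" "\<bar>f (z + d)\<bar> \<le> K" "\<bar>f (z + 2 * d)\<bar> \<le> K"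
      by (auto intro!: bdd)
    then show ?thesis unfolding p prod.case by linarith
  qed
  then have "bdd_above (?F ` ?I)" by (rule bdd_aboveI2[where M = "4 * K"])
  from cSUP_upper[OF _ this, of "(y, h)"] show ?thesis
    using assms(2-) by (simp add: omega2_def)
qed

text \<open>A second difference is a sum of two first differences from the midpoint, each at most
  \<open>L * h\<close>.\<close>

lemma omega2_le_lipschitz:
  assumes "L-lipschitz_on {0..1} f" "0 \<le> t"
  shows "omega2 f t \<le> 2 * L * t"
  unfolding omega2_def
proof (rule cSUP_least)
  show "{(x, h). 0 \<le> h \<and> h \<le> t \<and> x \<in> {0..1} \<and> x + 2 * h \<in> {0..1::real}} \<noteq> {}"
    using assms(2) by (auto intro!: exI[of _ 0])
  fix p assume p: "p \<in> {(x, h). 0 \<le> h \<and> h \<le> t \<and> x \<in> {0..1} \<and> x + 2 * h \<in> {0..1::real}}"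
  obtain z h where zh: "p = (z, h)" by (cases p)
  with p have h: "0 \<le> h" "h \<le> t" "z \<in> {0..1}" "z + h \<in> {0..1}" "z + 2 * h \<in> {0..1}" by auto
  have "\<bar>f z - f (z + h)\<bar> \<le> L * h" "\<bar>f (z + 2 * h) - f (z + h)\<bar> \<le> L * h"
    using lipschitz_onD[OF assms(1), of z "z + h"] lipschitz_onD[OF assms(1), of "z + 2 * h" "z + h"] h
    by (auto simp: dist_real_def)
  moreover have "L * h \<le> L * t"
    using h lipschitz_on_nonneg[OF assms(1)] by (intro mult_left_mono)
  ultimately show "(case p of (x, h) \<Rightarrow> \<bar>f x - 2 * f (x + h) + f (x + 2 * h)\<bar>) \<le> 2 * L * t"
    unfolding zh prod.case by linarith
qed

text \<open>Every difference quotient is a lower bound for the set of Lipschitz constants, hence at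
  most its infimum; the infimum is therefore attained.\<close>

lemma lipschitz_on_lip_seminorm:
  assumes "L-lipschitz_on {0..1} f"
  shows "(lip_seminorm f)-lipschitz_on {0..1} f"
proof -
  have ne: "{L. L-lipschitz_on {0..1} f} \<noteq> {}" using assms by blast
  show ?thesis
  proof (rule lipschitz_onI)
    fix x y :: real assume xy: "x \<in> {0..1}" "y \<in> {0..1}"
    show "dist (f x) (f y) \<le> lip_seminorm f * dist x y"
    proof (cases "x = y")
      case False
      then have "dist (f x) (f y) / dist x y \<le> lip_seminorm f"
        unfolding lip_seminorm_def using ne xy
        by (intro cInf_greatest) (auto simp: divide_le_eq intro: lipschitz_onD)
      with False show ?thesis by (simp add: divide_le_eq)
    qed simp
  next
    show "0 \<le> lip_seminorm f"
      unfolding lip_seminorm_def using ne by (intro cInf_greatest) (auto intro: lipschitz_on_nonneg)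
  qed
qed

section \<open>Combination of the approximation and quantization bounds\<close>

theorem theorem1:
  shows "\<exists>C::real. C > 0 \<and>
    (\<forall>(f :: real \<Rightarrow> real) (n :: nat).
      continuous_on {0..1} f \<and> f ` {0..1} \<subseteq> {-1..1} \<and> n > 0 \<longrightarrow>
      (\<exists>\<sigma> :: nat \<Rightarrow> real.
        (\<forall>k\<in>{0..n}. \<sigma> k \<in> {-1, 1}) \<and>
        (\<forall>x\<in>{0..1}.
          \<bar>f x - (\<Sum>k=0..n. \<sigma> k * Bernstein n k x)\<bar>
            \<le> C * (omega2 f (sqrt (x * (1 - x) / real n))
                    + 1 / (1 + sqrt (real n * (x * (1 - x)))))) \<and>
        ((\<exists>L. L-lipschitz_on {0..1} f) \<longrightarrow>
          (\<forall>x\<in>{0..1}.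
            \<bar>f x - (\<Sum>k=0..n. \<sigma> k * Bernstein n k x)\<bar>
              \<le> C * ((1 + lip_seminorm f) / (1 + sqrt (real n * (x * (1 - x)))))))))"
\<comment> \<open>The first estimate holds with 7. The Lipschitz bound \<open>2 * L * t\<close> on
  the modulus doubles this to 14, which serves both claims.\<close>
proof (intro exI[of _ 14] conjI allI impI)
  fix f :: "real \<Rightarrow> real" and n :: nat
  assume asm: "continuous_on {0..1} f \<and> f ` {0..1} \<subseteq> {-1..1} \<and> n > 0"
  then have bdd: "\<bar>f y\<bar> \<le> 1" if "y \<in> {0..1}" for y
    using that by (auto simp: abs_le_iff image_subset_iff)
  have n: "n > 0" using asm by blast
  have "\<bar>f (real k / real n)\<bar> \<le> 1" if "k \<le> n" for k
    using that n by (intro bdd) auto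
  then obtain \<sigma> :: "nat \<Rightarrow> real" where \<sigma>: "\<And>k. \<sigma> k \<in> {-1, 1}"
    and quant: "\<And>x. x \<in> {0..1} \<Longrightarrow>
      \<bar>(\<Sum>k\<le>n. f (real k / real n) * Bernstein n k x) - (\<Sum>k\<le>n. \<sigma> k * Bernstein n k x)\<bar>
      \<le> 3 / (1 + sqrt (real n * (x * (1 - x))))"
    using Bernstein_quantization[where n = n and a = "\<lambda>k. f (real k / real n)"] by blast
  let ?w = "\<lambda>x. omega2 f (sqrt (x * (1 - x) / real n))"
  let ?e = "\<lambda>x. 1 / (1 + sqrt (real n * (x * (1 - x))))"
  have main: "\<bar>f x - (\<Sum>k=0..n. \<sigma> k * Bernstein n k x)\<bar> \<le> 7 * (?w x + ?e x)"
    and w0: "0 \<le> ?w x" if x: "x \<in> {0..1}" for x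
  proof -
    have X: "0 \<le> x * (1 - x)" using x by simp
    then have e0: "0 \<le> ?e x" by simp
    show w0: "0 \<le> ?w x"
      \<comment> \<open>With \<open>h = 0\<close> at the point 0 the second difference is 0, which
        makes the modulus nonnegative.\<close>
      using second_difference_le_omega2[OF bdd, where h = 0 and y = 0] X by simp
    show "\<bar>f x - (\<Sum>k=0..n. \<sigma> k * Bernstein n k x)\<bar> \<le> 7 * (?w x + ?e x)"
    proof (cases "real n * (x * (1 - x)) \<ge> 1")
      case True
      have "\<bar>f x - (\<Sum>k\<le>n. f (real k / real n) * Bernstein n k x)\<bar> \<le> 7 * ?w x"
        by (rule Bernstein_approximation[OF n x True bdd])
          (auto intro: second_difference_le_omega2[OF bdd])
      with quant[OF x] e0 show ?thesis by (simp add: atLeast0AtMost)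
    next
      case False
      have "\<bar>\<Sum>k\<le>n. \<sigma> k * Bernstein n k x\<bar> \<le> (\<Sum>k\<le>n. \<bar>\<sigma> k * Bernstein n k x\<bar>)"
        by (rule sum_abs)
      also have "\<dots> = (\<Sum>k\<le>n. Bernstein n k x)"
      proof (rule sum.cong[OF refl])
        show "\<bar>\<sigma> k * Bernstein n k x\<bar> = Bernstein n k x" for k
          using \<sigma>[of k] x by (auto simp: abs_mult Bernstein_nonneg)
      qed
      finally have "\<bar>f x - (\<Sum>k=0..n. \<sigma> k * Bernstein n k x)\<bar> \<le> 2"
        using bdd[OF x] by (simp add: atLeast0AtMost)
      \<comment> \<open>Here \<open>n * x * (1 - x) < 1\<close> keeps the denominator below 2, so
        \<open>7 * ?e x\<close> already exceeds the trivial error bound 2.\<close>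
      moreover have "1 / 2 \<le> ?e x"
        using False X by (intro divide_left_mono) (auto intro: add_pos_nonneg)
      then have "2 \<le> 7 * (?w x + ?e x)" using w0 by argo
      ultimately show ?thesis by (rule order_trans)
    qed
  qed
  have lip: "\<bar>f x - (\<Sum>k=0..n. \<sigma> k * Bernstein n k x)\<bar>
      \<le> 14 * ((1 + lip_seminorm f) / (1 + sqrt (real n * (x * (1 - x)))))"
    if L: "\<exists>L. L-lipschitz_on {0..1} f" and x: "x \<in> {0..1}" for x
  proof -
    define X where "X = x * (1 - x)"
    define s where "s = sqrt (real n * X)"
    define t where "t = sqrt (X / real n)"
    define \<Lambda> where "\<Lambda> = lip_seminorm f"
    have Lip: "\<Lambda>-lipschitz_on {0..1} f"
      using L lipschitz_on_lip_seminorm by (auto simp: \<Lambda>_def)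
    have \<Lambda>0: "0 \<le> \<Lambda>" by (rule lipschitz_on_nonneg[OF Lip])
    have X: "0 \<le> X" using x by (simp add: X_def)
    have "0 \<le> (x - 1 / 2)\<^sup>2" by simp
    then have X4: "X \<le> 1 / 4" by (simp add: X_def power2_eq_square field_simps)
    have s0: "0 \<le> s" and t0: "0 \<le> t" using X by (simp_all add: s_def t_def)
    \<comment> \<open>Since \<open>t * s = X \<le> 1 / 4\<close> and \<open>t \<le> 1 / 2\<close>,
      also \<open>t * (1 + s) \<le> 1\<close>; this converts the scale \<open>t\<close> into the
      rate \<open>1 / (1 + s)\<close>.\<close>
    have "t * s = X"
      unfolding t_def s_def using X n by (simp flip: real_sqrt_mult)
    moreover have "t \<le> 1 / 2"
    proof -
      have "X / real n \<le> X" using X n using mult_left_mono[of 1 "real n" X] by (simp add: divide_le_eq)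
      also have "\<dots> \<le> (1 / 2)\<^sup>2" using X4 by (simp add: power2_eq_square)
      finally show ?thesis unfolding t_def by (intro real_le_lsqrt) simp_all
    qed
    ultimately have "t * (1 + s) \<le> 1" using X4 by (simp add: distrib_left)
    then have ts: "t \<le> 1 / (1 + s)" using s0 by (simp add: field_simps)
    have "?w x \<le> 2 * \<Lambda> * t"
      using omega2_le_lipschitz[OF Lip t0] by (simp add: t_def X_def)
    also have "\<dots> \<le> 2 * \<Lambda> * (1 / (1 + s))"
      using ts \<Lambda>0 by (intro mult_left_mono) auto
    finally have "7 * (?w x + ?e x) \<le> 7 * (2 * \<Lambda> * (1 / (1 + s)) + 1 / (1 + s))"
      by (simp add: s_def X_def)
    also have "\<dots> \<le> 14 * ((1 + \<Lambda>) / (1 + s))"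
      using s0 by (simp add: field_simps)
    finally show ?thesis using main[OF x] by (simp add: s_def X_def \<Lambda>_def)
  qed
  show "\<exists>\<sigma> :: nat \<Rightarrow> real.
        (\<forall>k\<in>{0..n}. \<sigma> k \<in> {-1, 1}) \<and>
        (\<forall>x\<in>{0..1}. \<bar>f x - (\<Sum>k=0..n. \<sigma> k * Bernstein n k x)\<bar> \<le> 14 * (?w x + ?e x)) \<and>
        ((\<exists>L. L-lipschitz_on {0..1} f) \<longrightarrow>
          (\<forall>x\<in>{0..1}. \<bar>f x - (\<Sum>k=0..n. \<sigma> k * Bernstein n k x)\<bar>
              \<le> 14 * ((1 + lip_seminorm f) / (1 + sqrt (real n * (x * (1 - x)))))))"
  proof (intro exI[of _ \<sigma>] conjI ballI impI)
    fix x :: real assume x: "x \<in> {0..1}"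
    have "0 \<le> ?e x" using x by simp
    then show "\<bar>f x - (\<Sum>k=0..n. \<sigma> k * Bernstein n k x)\<bar> \<le> 14 * (?w x + ?e x)"
      using main[OF x] w0[OF x] by linarith
  qed (use \<sigma> lip in auto)
qed simp

end
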